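(* Let $\mathbb{R}=(R,r)$ be an epireflector and $\mathbb{T}=(T,\mu,\eta)$ a monad on a category $\mathbf{C}$. If $\mathbb{R}\circ\mathbb{T}$ is a monad (i.e. the composite monad exists) and $R\eta_X:RX\to RTX$ is an epimorphism in $R(\mathbf{C})$ for every object $X$ of $\mathbf{C}$, then the category $\mathbf{C}^{\mathbb{R}\circ\mathbb{T}}$ of $\mathbb{R}\circ\mathbb{T}$-algebras is isomorphic to a reflective subcategory of $R(\mathbf{C})$ and to a reflective subcategory of $\mathbf{C}$.
   Context: A reflective subcategory of $\mathbf{C}$ is a full subcategory whose inclusion into $\mathbf{C}$ has a left adjoint $R$; with unit $r:1\to R$, the pair $\mathbb{R}=(R,r)$ is called a reflector, the reflective subcategory is denoted $R(\mathbf{C})$, and $R$ is regarded as an endofunctor of $\mathbf{C}$ (an idempotent monad with unit $r$ and multiplication $(r_R)^{-1}:RR\to R$). $(R,r)$ is an epireflector if each $r_X$ is an epimorphism in $\mathbf{C}$. For a monad $\mathbb{T}=(T,\mu,\eta)$, a $\mathbb{T}$-algebra is a pair $(X,a)$ with $a:TX\to X$ satisfying $a\cdot Ta=a\cdot\mu_X$ and $a\cdot\eta_X=1_X$; a homomorphism $f:(X,a)\to(Y,b)$ is a morphism $f:X\to Y$ with $f\cdot a=b\cdot Tf$. $\mathbf{C}^{\mathbb{T}}$ is the category of $\mathbb{T}$-algebras and $G^{\mathbb{T}}:\mathbf{C}^{\mathbb{T}}\to\mathbf{C}$ the forgetful functor. Composite monad: "$\mathbb{R}\circ\mathbb{T}$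 is a monad" means that $R$ lifts to $\mathbf{C}^{\mathbb{T}}$, i.e. there is a monad $\tilde{\mathbb{R}}=(\tilde{R},n,d)$ on $\mathbf{C}^{\mathbb{T}}$ with $G^{\mathbb{T}}\tilde{R}=RG^{\mathbb{T}}$, whose unit $d$ and multiplication $n$ have as underlying natural transformations the unit $rG^{\mathbb{T}}$ and multiplication of $R$. Then $\mathbb{R}\circ\mathbb{T}=(RT,w,r\circ\eta)$, where $(r\circ\eta)_X=r_{TX}\cdot\eta_X$ and, writing $\tilde{R}(TX,\mu_X)=(RTX,\tilde{\mu}_X)$ with $\tilde{\mu}_X:TRTX\to RTX$, $w_X:RTRTX\to RTX$ is the unique morphism with $w_X\cdot r_{TRTX}=\tilde{\mu}_X$.
   Formalization: Reflective subcategories are taken to be closed under isomorphism, in hypothesis and conclusion; without this the claim about R(C) fails (T the identity, C indiscrete on two objects, R(C) one of them). *)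

theory Defs
  imports Main
begin

text \<open>
  Objects and morphisms are the elements of two carrier sets over arbitrary types; the values of
  the operations outside these carriers are irrelevant.
\<close>

record ('o, 'm) cat =
  Obj :: "'o set"
  Arr :: "'m set"
  Dom :: "'m \<Rightarrow> 'o"
  Cod :: "'m \<Rightarrow> 'o"
  Id :: "'o \<Rightarrow> 'm"
  Comp :: "'m \<Rightarrow> 'm \<Rightarrow> 'm" (infixl "\<cdot>\<index>" 70)

definition hom :: "('o, 'm) cat \<Rightarrow> 'o \<Rightarrow> 'o \<Rightarrow> 'm set" where
  "hom C X Y = {f \<in> Arr C. Dom C f = X \<and> Cod C f = Y}"

locale category =
  fixes C :: "('o, 'm) cat" (structure)
  assumes dom_obj: "f \<in> Arr C \<Longrightarrow> Dom C f \<in> Obj C"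
    and cod_obj: "f \<in> Arr C \<Longrightarrow> Cod C f \<in> Obj C"
    and id_hom: "X \<in> Obj C \<Longrightarrow> Id C X \<in> hom C X X"
    and comp_hom: "f \<in> hom C X Y \<Longrightarrow> g \<in> hom C Y Z \<Longrightarrow> g \<cdot> f \<in> hom C X Z"
    and id_left: "f \<in> hom C X Y \<Longrightarrow> Id C Y \<cdot> f = f"
    and id_right: "f \<in> hom C X Y \<Longrightarrow> f \<cdot> Id C X = f"
    and assoc: "f \<in> hom C W X \<Longrightarrow> g \<in> hom C X Y \<Longrightarrow> h \<in> hom C Y Z \<Longrightarrow>
      h \<cdot> (g \<cdot> f) = (h \<cdot> g) \<cdot> f"

definition epi :: "('o, 'm) cat \<Rightarrow> 'm \<Rightarrow> bool" where
  "epi C f \<longleftrightarrow> f \<in> Arr C \<and>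
     (\<forall>Z. \<forall>g \<in> hom C (Cod C f) Z. \<forall>h \<in> hom C (Cod C f) Z.
        g \<cdot>\<^bsub>C\<^esub> f = h \<cdot>\<^bsub>C\<^esub> f \<longrightarrow> g = h)"

definition inverse_of :: "('o, 'm) cat \<Rightarrow> 'm \<Rightarrow> 'm \<Rightarrow> bool" where
  "inverse_of C f g \<longleftrightarrow> f \<in> Arr C \<and> g \<in> hom C (Cod C f) (Dom C f) \<and>
     g \<cdot>\<^bsub>C\<^esub> f = Id C (Dom C f) \<and> f \<cdot>\<^bsub>C\<^esub> g = Id C (Cod C f)"

definition iso :: "('o, 'm) cat \<Rightarrow> 'm \<Rightarrow> bool" where
  "iso C f \<longleftrightarrow> (\<exists>g. inverse_of C f g)"

definition inv_arr :: "('o, 'm) cat \<Rightarrow> 'm \<Rightarrow> 'm" where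
  "inv_arr C f = (THE g. inverse_of C f g)"


record ('o1, 'm1, 'o2, 'm2) fctr =
  obm :: "'o1 \<Rightarrow> 'o2"
  arm :: "'m1 \<Rightarrow> 'm2"

definition is_functor ::
  "('o1, 'm1) cat \<Rightarrow> ('o2, 'm2) cat \<Rightarrow> ('o1, 'm1, 'o2, 'm2) fctr \<Rightarrow> bool" where
  "is_functor C D F \<longleftrightarrow> category C \<and> category D \<and>
     (\<forall>X \<in> Obj C. obm F X \<in> Obj D) \<and>
     (\<forall>X \<in> Obj C. \<forall>Y \<in> Obj C. \<forall>f \<in> hom C X Y. arm F f \<in> hom D (obm F X) (obm F Y)) \<and>
     (\<forall>X \<in> Obj C. arm F (Id C X) = Id D (obm F X)) \<and>
     (\<forall>f \<in> Arr C. \<forall>g \<in> Arr C. Cod C f = Dom C g \<longrightarrow>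
        arm F (g \<cdot>\<^bsub>C\<^esub> f) = arm F g \<cdot>\<^bsub>D\<^esub> arm F f)"

text \<open>Equality of functors with source \<open>C\<close>; values outside the carriers are irrelevant.\<close>

definition functor_eq ::
  "('o1, 'm1) cat \<Rightarrow> ('o1, 'm1, 'o2, 'm2) fctr \<Rightarrow> ('o1, 'm1, 'o2, 'm2) fctr \<Rightarrow> bool" where
  "functor_eq C F G \<longleftrightarrow> (\<forall>X \<in> Obj C. obm F X = obm G X) \<and> (\<forall>f \<in> Arr C. arm F f = arm G f)"

definition fid :: "('o, 'm, 'o, 'm) fctr" where
  "fid = \<lparr>obm = (\<lambda>X. X), arm = (\<lambda>f. f)\<rparr>"

definition fcomp ::
  "('o2, 'm2, 'o3, 'm3) fctr \<Rightarrow> ('o1, 'm1, 'o2, 'm2) fctr \<Rightarrow> ('o1, 'm1, 'o3, 'm3) fctr"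
  (infixl "\<circ>\<^sub>F" 55) where
  "G \<circ>\<^sub>F F = \<lparr>obm = obm G \<circ> obm F, arm = arm G \<circ> arm F\<rparr>"

definition nat_trans ::
  "('o1, 'm1) cat \<Rightarrow> ('o2, 'm2) cat \<Rightarrow> ('o1, 'm1, 'o2, 'm2) fctr \<Rightarrow>
   ('o1, 'm1, 'o2, 'm2) fctr \<Rightarrow> ('o1 \<Rightarrow> 'm2) \<Rightarrow> bool" where
  "nat_trans C D F G t \<longleftrightarrow> is_functor C D F \<and> is_functor C D G \<and>
     (\<forall>X \<in> Obj C. t X \<in> hom D (obm F X) (obm G X)) \<and>
     (\<forall>X \<in> Obj C. \<forall>Y \<in> Obj C. \<forall>f \<in> hom C X Y.
        t Y \<cdot>\<^bsub>D\<^esub> arm F f = arm G f \<cdot>\<^bsub>D\<^esub> t X)"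

definition isomorphic :: "('o1, 'm1) cat \<Rightarrow> ('o2, 'm2) cat \<Rightarrow> bool" where
  "isomorphic C D \<longleftrightarrow> (\<exists>F G. is_functor C D F \<and> is_functor D C G \<and>
     functor_eq C (G \<circ>\<^sub>F F) fid \<and> functor_eq D (F \<circ>\<^sub>F G) fid)"

text \<open>\<open>F\<close> is left adjoint to \<open>G\<close> with unit \<open>e\<close>.\<close>

definition adjunction ::
  "('o1, 'm1) cat \<Rightarrow> ('o2, 'm2) cat \<Rightarrow> ('o1, 'm1, 'o2, 'm2) fctr \<Rightarrow>
   ('o2, 'm2, 'o1, 'm1) fctr \<Rightarrow> ('o1 \<Rightarrow> 'm1) \<Rightarrow> bool" where
  "adjunction C D F G e \<longleftrightarrow> is_functor C D F \<and> is_functor D C G \<and>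
     nat_trans C C fid (G \<circ>\<^sub>F F) e \<and>
     (\<forall>X \<in> Obj C. \<forall>Y \<in> Obj D. \<forall>f \<in> hom C X (obm G Y).
        \<exists>!g. g \<in> hom D (obm F X) Y \<and> arm G g \<cdot>\<^bsub>C\<^esub> e X = f)"


definition full_sub :: "('o, 'm) cat \<Rightarrow> 'o set \<Rightarrow> ('o, 'm) cat" where
  "full_sub C A = C\<lparr>Obj := A, Arr := {f \<in> Arr C. Dom C f \<in> A \<and> Cod C f \<in> A}\<rparr>"

definition replete :: "('o, 'm) cat \<Rightarrow> 'o set \<Rightarrow> bool" where
  "replete C A \<longleftrightarrow> (\<forall>f. iso C f \<and> Dom C f \<in> A \<longrightarrow> Cod C f \<in> A)"

text \<open>
  The subcategory \<open>R(C)\<close> is \<open>full_sub C A\<close>. Reflective subcategories are closed under isomorphism,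
  so that \<open>A\<close> is determined by the reflector: it consists of all \<open>X\<close> with \<open>r X\<close> invertible.
  Since the inclusion is the identity on objects and morphisms, \<open>R\<close> is at the same time a functor
  from \<open>C\<close> to the subcategory and an endofunctor of \<open>C\<close>.
\<close>

definition reflector ::
  "('o, 'm) cat \<Rightarrow> 'o set \<Rightarrow> ('o, 'm, 'o, 'm) fctr \<Rightarrow> ('o \<Rightarrow> 'm) \<Rightarrow> bool" where
  "reflector C A R r \<longleftrightarrow> A \<subseteq> Obj C \<and> replete C A \<and> adjunction C (full_sub C A) R fid r"

definition reflective :: "('o, 'm) cat \<Rightarrow> 'o set \<Rightarrow> bool" where
  "reflective C A \<longleftrightarrow> (\<exists>R r. reflector C A R r)"

definition epireflector ::
  "('o, 'm) cat \<Rightarrow> 'o set \<Rightarrow> ('o, 'm, 'o, 'm) fctr \<Rightarrow> ('o \<Rightarrow> 'm) \<Rightarrow> bool" where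
  "epireflector C A R r \<longleftrightarrow> reflector C A R r \<and> (\<forall>X \<in> Obj C. epi C (r X))"


record ('o, 'm) mnd =
  Endo :: "('o, 'm, 'o, 'm) fctr"
  Mult :: "'o \<Rightarrow> 'm"
  Unit :: "'o \<Rightarrow> 'm"

definition monad :: "('o, 'm) cat \<Rightarrow> ('o, 'm) mnd \<Rightarrow> bool" where
  "monad C M \<longleftrightarrow>
     nat_trans C C (Endo M \<circ>\<^sub>F Endo M) (Endo M) (Mult M) \<and>
     nat_trans C C fid (Endo M) (Unit M) \<and>
     (\<forall>X \<in> Obj C.
        Mult M X \<cdot>\<^bsub>C\<^esub> arm (Endo M) (Mult M X) = Mult M X \<cdot>\<^bsub>C\<^esub> Mult M (obm (Endo M) X) \<and>
        Mult M X \<cdot>\<^bsub>C\<^esub> arm (Endo M) (Unit M X) = Id C (obm (Endo M) X) \<and>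
        Mult M X \<cdot>\<^bsub>C\<^esub> Unit M (obm (Endo M) X) = Id C (obm (Endo M) X))"

definition reflector_monad ::
  "('o, 'm) cat \<Rightarrow> ('o, 'm, 'o, 'm) fctr \<Rightarrow> ('o \<Rightarrow> 'm) \<Rightarrow> ('o, 'm) mnd" where
  "reflector_monad C R r =
     \<lparr>Endo = R, Mult = (\<lambda>X. inv_arr C (r (obm R X))), Unit = r\<rparr>"

definition algebras :: "('o, 'm) cat \<Rightarrow> ('o, 'm) mnd \<Rightarrow> ('o \<times> 'm) set" where
  "algebras C M = {(X, a). X \<in> Obj C \<and> a \<in> hom C (obm (Endo M) X) X \<and>
     a \<cdot>\<^bsub>C\<^esub> arm (Endo M) a = a \<cdot>\<^bsub>C\<^esub> Mult M X \<and> a \<cdot>\<^bsub>C\<^esub> Unit M X = Id C X}"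

definition alg_hom :: "('o, 'm) cat \<Rightarrow> ('o, 'm) mnd \<Rightarrow> 'o \<times> 'm \<Rightarrow> 'o \<times> 'm \<Rightarrow> 'm \<Rightarrow> bool" where
  "alg_hom C M A B f \<longleftrightarrow> A \<in> algebras C M \<and> B \<in> algebras C M \<and> f \<in> hom C (fst A) (fst B) \<and>
     f \<cdot>\<^bsub>C\<^esub> snd A = snd B \<cdot>\<^bsub>C\<^esub> arm (Endo M) f"

text \<open>
  One morphism of \<open>C\<close> can underlie homomorphisms between different algebras, so a morphism of
  algebras is recorded together with its domain and codomain.
\<close>

definition alg_cat ::
  "('o, 'm) cat \<Rightarrow> ('o, 'm) mnd \<Rightarrow> ('o \<times> 'm, ('o \<times> 'm) \<times> 'm \<times> ('o \<times> 'm)) cat" where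
  "alg_cat C M =
     \<lparr>Obj = algebras C M,
      Arr = {(A, f, B). alg_hom C M A B f},
      Dom = (\<lambda>(A, f, B). A),
      Cod = (\<lambda>(A, f, B). B),
      Id = (\<lambda>A. (A, Id C (fst A), A)),
      Comp = (\<lambda>(B', g, D) (A, f, B). (A, g \<cdot>\<^bsub>C\<^esub> f, D))\<rparr>"

definition forget :: "('o \<times> 'm, ('o \<times> 'm) \<times> 'm \<times> ('o \<times> 'm), 'o, 'm) fctr" where
  "forget = \<lparr>obm = fst, arm = (\<lambda>(A, f, B). f)\<rparr>"

text \<open>\<open>L\<close> is a lifting of the monad \<open>R\<close> on \<open>C\<close> to the category of \<open>T\<close>-algebras.\<close>

definition monad_lifting ::
  "('o, 'm) cat \<Rightarrow> ('o, 'm) mnd \<Rightarrow> ('o, 'm) mnd \<Rightarrow>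
   ('o \<times> 'm, ('o \<times> 'm) \<times> 'm \<times> ('o \<times> 'm)) mnd \<Rightarrow> bool" where
  "monad_lifting C R T L \<longleftrightarrow> monad (alg_cat C T) L \<and>
     functor_eq (alg_cat C T) (forget \<circ>\<^sub>F Endo L) (Endo R \<circ>\<^sub>F forget) \<and>
     (\<forall>A \<in> Obj (alg_cat C T).
        arm forget (Unit L A) = Unit R (obm forget A) \<and>
        arm forget (Mult L A) = Mult R (obm forget A))"

text \<open>
  The composite monad \<open>R \<circ> T\<close> obtained from a lifting \<open>L\<close> of the reflector \<open>(R, r)\<close>. The second
  component of \<open>L\<close> at the free algebra \<open>(T X, \<mu> X)\<close> is the action of \<open>T\<close> on \<open>R (T X)\<close>.
\<close>

definition composite_monad ::
  "('o, 'm) cat \<Rightarrow> ('o, 'm, 'o, 'm) fctr \<Rightarrow> ('o \<Rightarrow> 'm) \<Rightarrow> ('o, 'm) mnd \<Rightarrow>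
   ('o \<times> 'm, ('o \<times> 'm) \<times> 'm \<times> ('o \<times> 'm)) mnd \<Rightarrow> ('o, 'm) mnd" where
  "composite_monad C R r T L =
     (let RT = R \<circ>\<^sub>F Endo T in
      \<lparr>Endo = RT,
       Mult = (\<lambda>X. THE w. w \<in> hom C (obm RT (obm RT X)) (obm RT X) \<and>
          w \<cdot>\<^bsub>C\<^esub> r (obm (Endo T) (obm RT X)) =
            snd (obm (Endo L) (obm (Endo T) X, Mult T X))),
       Unit = (\<lambda>X. r (obm (Endo T) X) \<cdot>\<^bsub>C\<^esub> Unit T X)\<rparr>)"

end

theory Submission
  imports Defs
begin

text \<open>
  Let \<open>M = R \<circ> T\<close> with unit \<open>u X = r (T X) \<cdot> \<eta> X\<close>. By naturality of \<open>r\<close> also \<open>u X = R (\<eta> X) \<cdot> r X\<close>.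
  A morphism from \<open>R X\<close> into an object of \<open>R(C)\<close> is determined by its composite with \<open>r X\<close>, and
  \<open>R (\<eta> X)\<close> is an epimorphism of \<open>R(C)\<close>; hence a morphism from \<open>M X\<close> into an object of \<open>R(C)\<close>, in
  particular one into some \<open>M Y\<close>, is determined by its composite with \<open>u X\<close>
  (\<open>composite_cancellable_unit\<close>).

  This makes every algebra structure \<open>a\<close> on \<open>X\<close> a two-sided inverse of \<open>u X\<close>: from \<open>a \<cdot> u X = 1\<close>
  one gets \<open>(u X \<cdot> a) \<cdot> u X = 1 \<cdot> u X\<close>, and both \<open>u X \<cdot> a\<close> and \<open>1\<close> are endomorphisms of \<open>M X\<close>.
  Conversely, if \<open>u X\<close> is invertible, its inverse is an algebra structure. So being an algebra is a
  property of an object, and naturality of \<open>u\<close> makes every morphism between two such objects a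
  homomorphism. The category of algebras is therefore isomorphic to the full subcategory \<open>B\<close> of the
  objects with invertible unit (\<open>alg_cat_isomorphic_unit_fixed\<close>).

  Applied to the multiplication of \<open>M\<close>, the same cancellation puts every \<open>M X\<close> into \<open>B\<close>. For \<open>Y\<close>
  in \<open>B\<close>, a morphism \<open>f : X \<rightarrow> Y\<close> factors through \<open>u X\<close> as the inverse of \<open>u Y\<close> after \<open>M f\<close>, and
  only in this way. So \<open>u\<close> exhibits \<open>B\<close> as a reflective subcategory of \<open>C\<close>
  (\<open>reflector_unit_fixed\<close>). An object of \<open>B\<close> is isomorphic to some \<open>M X\<close>, which lies in \<open>R(C)\<close>;
  so \<open>B\<close> is contained in \<open>R(C)\<close>, and the reflector restricts to \<open>R(C)\<close> (\<open>reflector_restrict\<close>).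
\<close>

section \<open>Full subcategories and inverses\<close>

lemma full_sub_simps [simp]:
  "Obj (full_sub C A) = A"
  "Arr (full_sub C A) = {f \<in> Arr C. Dom C f \<in> A \<and> Cod C f \<in> A}"
  "Dom (full_sub C A) = Dom C"
  "Cod (full_sub C A) = Cod C"
  "Id (full_sub C A) = Id C"
  "Comp (full_sub C A) = Comp C"
  by (simp_all add: full_sub_def)

lemma hom_full_sub: "f \<in> hom (full_sub C A) X Y \<longleftrightarrow> f \<in> hom C X Y \<and> X \<in> A \<and> Y \<in> A"
  by (auto simp: hom_def)

lemma full_sub_full_sub: "B \<subseteq> A \<Longrightarrow> full_sub (full_sub C A) B = full_sub C B"
  by (auto simp: full_sub_def intro!: arg_cong[of _ _ "\<lambda>S. Arr_update (\<lambda>_. S) _"])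

context category
begin

lemma hom_obj: "f \<in> hom C X Y \<Longrightarrow> X \<in> Obj C \<and> Y \<in> Obj C"
  using dom_obj cod_obj by (auto simp: hom_def)

lemma category_full_sub:
  assumes "A \<subseteq> Obj C"
  shows "category (full_sub C A)"
  using assms id_hom
  by unfold_locales (auto simp: hom_full_sub comp_hom id_left id_right assoc)

lemma inverse_of_hom:
  assumes "f \<in> hom C X Y"
  shows "inverse_of C f g \<longleftrightarrow> g \<in> hom C Y X \<and> g \<cdot> f = Id C X \<and> f \<cdot> g = Id C Y"
  using assms by (auto simp: inverse_of_def hom_def)

lemma inverse_of_unique:
  assumes "inverse_of C f g" "inverse_of C f h"
  shows "g = h"
proof -
  obtain X Y where f: "f \<in> hom C X Y" using assms(1) by (auto simp: inverse_of_def hom_def)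
  have g: "g \<in> hom C Y X" "f \<cdot> g = Id C Y" and h: "h \<in> hom C Y X" "h \<cdot> f = Id C X"
    using assms by (simp_all add: inverse_of_hom[OF f])
  have "g = (h \<cdot> f) \<cdot> g" using g h by (simp add: id_left)
  also have "\<dots> = h \<cdot> (f \<cdot> g)" using assoc[OF g(1) f h(1)] by simp
  also have "\<dots> = h" using g h by (simp add: id_right)
  finally show ?thesis .
qed

lemma inv_arr_eq: "inverse_of C f g \<Longrightarrow> inv_arr C f = g"
  unfolding inv_arr_def using inverse_of_unique by blast

lemma inv_arr_inverse: "iso C f \<Longrightarrow> inverse_of C f (inv_arr C f)"
  using inv_arr_eq by (auto simp: iso_def)

lemma iso_inverse: "inverse_of C f g \<Longrightarrow> iso C g"
  by (auto simp: iso_def inverse_of_def hom_def intro!: exI[of _ f])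

end

section \<open>Functors and reflectors\<close>

lemma fid_simps [simp]: "obm fid X = X" "arm fid f = f"
  by (simp_all add: fid_def)

lemma fcomp_simps [simp]:
  "obm (G \<circ>\<^sub>F F) X = obm G (obm F X)" "arm (G \<circ>\<^sub>F F) f = arm G (arm F f)"
  by (simp_all add: fcomp_def)

lemma fid_fcomp [simp]: "fid \<circ>\<^sub>F F = F"
  by (simp add: fcomp_def fid_def comp_def)

lemma functor_obj: "is_functor C D F \<Longrightarrow> X \<in> Obj C \<Longrightarrow> obm F X \<in> Obj D"
  by (simp add: is_functor_def)

lemma functor_hom:
  "is_functor C D F \<Longrightarrow> f \<in> hom C X Y \<Longrightarrow> arm F f \<in> hom D (obm F X) (obm F Y)"
  unfolding is_functor_def using category.hom_obj by metis

lemma functor_id: "is_functor C D F \<Longrightarrow> X \<in> Obj C \<Longrightarrow> arm F (Id C X) = Id D (obm F X)"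
  by (simp add: is_functor_def)

lemma functor_comp:
  "is_functor C D F \<Longrightarrow> f \<in> hom C X Y \<Longrightarrow> g \<in> hom C Y Z \<Longrightarrow>
   arm F (g \<cdot>\<^bsub>C\<^esub> f) = arm F g \<cdot>\<^bsub>D\<^esub> arm F f"
  by (auto simp: is_functor_def hom_def)

lemma functor_fcomp:
  assumes "is_functor C D F" "is_functor D E G"
  shows "is_functor C E (G \<circ>\<^sub>F F)"
proof -
  have "arm G (arm F (g \<cdot>\<^bsub>C\<^esub> f)) = arm G (arm F g) \<cdot>\<^bsub>E\<^esub> arm G (arm F f)"
    if "f \<in> Arr C" "g \<in> Arr C" "Cod C f = Dom C g" for f g
  proof -
    have f: "f \<in> hom C (Dom C f) (Cod C f)" and g: "g \<in> hom C (Cod C f) (Cod C g)"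
      using that by (auto simp: hom_def)
    show ?thesis
      using functor_comp[OF assms(1) f g] 
        functor_comp[OF assms(2) functor_hom[OF assms(1) f] functor_hom[OF assms(1) g]]
      by simp
  qed
  moreover have "category C" "category E" using assms by (simp_all add: is_functor_def)
  ultimately show ?thesis
    using assms by (auto simp: is_functor_def[of C E] functor_id functor_obj intro!: functor_hom)
qed

lemma functor_inclusion:
  assumes "category C" "A \<subseteq> Obj C"
  shows "is_functor (full_sub C A) C fid"
  using assms category.category_full_sub[OF assms]
  by (auto simp: is_functor_def hom_full_sub)

lemma functor_into_full_sub:
  assumes "is_functor C D F" "A \<subseteq> Obj D" "\<And>X. X \<in> Obj C \<Longrightarrow> obm F X \<in> A"
  shows "is_functor C (full_sub D A) F"
  using assms category.category_full_sub[of D A]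
  by (auto simp: is_functor_def hom_full_sub)

lemma functor_on_full_sub:
  assumes "is_functor C D F" "A \<subseteq> Obj C"
  shows "is_functor (full_sub C A) D F"
  using assms category.category_full_sub[of C A]
  by (auto simp: is_functor_def hom_full_sub subset_iff)

lemma nat_hom: "nat_trans C D F G t \<Longrightarrow> X \<in> Obj C \<Longrightarrow> t X \<in> hom D (obm F X) (obm G X)"
  by (simp add: nat_trans_def)

lemma naturality:
  "nat_trans C D F G t \<Longrightarrow> f \<in> hom C X Y \<Longrightarrow> t Y \<cdot>\<^bsub>D\<^esub> arm F f = arm G f \<cdot>\<^bsub>D\<^esub> t X"
  unfolding nat_trans_def is_functor_def using category.hom_obj by metis

lemma functor_fid: "category C \<Longrightarrow> is_functor C C fid"
  by (auto simp: is_functor_def)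

text \<open>
  The inclusion of a full subcategory acts as the identity, so its adjunction with the reflector
  can be stated and established entirely inside the ambient category.
\<close>

lemma reflectorI:
  assumes B: "B \<subseteq> Obj C" and rep: "replete C B" and nat: "nat_trans C C fid R r"
    and into: "\<And>X. X \<in> Obj C \<Longrightarrow> obm R X \<in> B"
    and universal: "\<And>X Y f. Y \<in> B \<Longrightarrow> f \<in> hom C X Y \<Longrightarrow>
      \<exists>!g. g \<in> hom C (obm R X) Y \<and> g \<cdot>\<^bsub>C\<^esub> r X = f"
  shows "reflector C B R r"
proof -
  have cat: "category C" and R: "is_functor C C R" using nat by (auto simp: nat_trans_def is_functor_def)
  show ?thesis
    unfolding reflector_def adjunction_def
    using B rep nat into universal functor_inclusion[OF cat B] functor_into_full_sub[OF R B into]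
    by (auto simp: hom_full_sub)
qed

lemma reflector_nat: "reflector C A R r \<Longrightarrow> nat_trans C C fid R r"
  by (simp add: reflector_def adjunction_def)

lemma reflector_functor: "reflector C A R r \<Longrightarrow> is_functor C C R"
  using reflector_nat by (auto simp: nat_trans_def)

lemma reflector_obj: "reflector C A R r \<Longrightarrow> X \<in> Obj C \<Longrightarrow> obm R X \<in> A"
  using functor_obj[of C "full_sub C A"] by (auto simp: reflector_def adjunction_def)

lemma reflector_universal:
  assumes "reflector C A R r" "Y \<in> A" "f \<in> hom C X Y"
  shows "\<exists>!g. g \<in> hom C (obm R X) Y \<and> g \<cdot>\<^bsub>C\<^esub> r X = f"
proof -
  have adj: "adjunction C (full_sub C A) R fid r" using assms(1) by (simp add: reflector_def)
  then have "category C" by (simp add: adjunction_def is_functor_def)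
  then have X: "X \<in> Obj C" using assms(3) category.hom_obj by metis
  have "\<exists>!g. g \<in> hom (full_sub C A) (obm R X) Y \<and> g \<cdot>\<^bsub>C\<^esub> r X = f"
    using adj X assms(2,3) by (simp add: adjunction_def)
  then show ?thesis using reflector_obj[OF assms(1) X] assms(2) by (simp add: hom_full_sub)
qed

text \<open>
  The reflections already lie in the intermediate category, and the universal property only
  speaks of morphisms between objects of that full subcategory.
\<close>

lemma reflector_restrict:
  assumes refl: "reflector C B R r" and "B \<subseteq> A" "A \<subseteq> Obj C"
  shows "reflector (full_sub C A) B R r"
proof (rule reflectorI)
  have nat: "nat_trans C C fid R r" by (rule reflector_nat[OF refl])
  then have cat: "category C" and R: "is_functor C C R"
    by (auto simp: nat_trans_def is_functor_def)
  have into: "obm R X \<in> B" if "X \<in> A" for X using reflector_obj[OF refl] that assms(3) by blast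
  show "B \<subseteq> Obj (full_sub C A)" using assms by simp
  show "obm R X \<in> B" if "X \<in> Obj (full_sub C A)" for X using into that by simp
  have "iso C f" if "iso (full_sub C A) f" for f
    using that by (auto simp: iso_def inverse_of_def hom_full_sub)
  then show "replete (full_sub C A) B"
    using refl by (auto simp: replete_def reflector_def)
  have "is_functor (full_sub C A) (full_sub C A) R"
    by (intro functor_into_full_sub functor_on_full_sub R assms) (use into assms in auto)
  moreover have "is_functor (full_sub C A) (full_sub C A) fid"
    by (intro functor_fid category.category_full_sub cat assms)
  ultimately show "nat_trans (full_sub C A) (full_sub C A) fid R r"
    using nat_hom[OF nat] naturality[OF nat] into assms
    by (auto simp: nat_trans_def hom_full_sub)
  show "\<exists>!g. g \<in> hom (full_sub C A) (obm R X) Y \<and> g \<cdot>\<^bsub>full_sub C A\<^esub> r X = f"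
    if "Y \<in> B" "f \<in> hom (full_sub C A) X Y" for X Y f
  proof -
    have "X \<in> A" "Y \<in> A" "obm R X \<in> A" using that into assms by (auto simp: hom_full_sub)
    then show ?thesis using reflector_universal[OF refl that(1)] that by (simp add: hom_full_sub)
  qed
qed

section \<open>Algebras of an endofunctor with a cancellable unit\<close>

lemma alg_cat_simps [simp]:
  "Obj (alg_cat C M) = algebras C M"
  "Arr (alg_cat C M) = {(A, f, B). alg_hom C M A B f}"
  "Dom (alg_cat C M) (A, f, B) = A"
  "Cod (alg_cat C M) (A, f, B) = B"
  "Id (alg_cat C M) A = (A, Id C (fst A), A)"
  "(B', g, D) \<cdot>\<^bsub>alg_cat C M\<^esub> (A, f, B) = (A, g \<cdot>\<^bsub>C\<^esub> f, D)"
  by (simp_all add: alg_cat_def)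

lemma hom_alg_cat: "p \<in> hom (alg_cat C M) A B \<longleftrightarrow> (\<exists>f. p = (A, f, B) \<and> alg_hom C M A B f)"
  by (auto simp: hom_def)

lemma category_alg_cat:
  fixes C :: "('o, 'm) cat" (structure)
  assumes M: "is_functor C C (Endo M)"
  shows "category (alg_cat C M)"
proof -
  interpret category C using M by (simp add: is_functor_def)
  have idh: "alg_hom C M A A (Id C (fst A))" if "A \<in> algebras C M" for A
    using that M by (auto simp: alg_hom_def algebras_def functor_id id_hom id_left id_right)
  have comph: "alg_hom C M A D (g \<cdot> f)" if f: "alg_hom C M A B f" and g: "alg_hom C M B D g" 
    for A B D f g
  proof -
    have A: "snd A \<in> hom C (obm (Endo M) (fst A)) (fst A)"
      and B: "snd B \<in> hom C (obm (Endo M) (fst B)) (fst B)"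
      and D: "snd D \<in> hom C (obm (Endo M) (fst D)) (fst D)"
      and fh: "f \<in> hom C (fst A) (fst B)" and gh: "g \<in> hom C (fst B) (fst D)"
      using f g by (auto simp: alg_hom_def algebras_def)
    note Mf = functor_hom[OF M fh] and Mg = functor_hom[OF M gh]
    have "(g \<cdot> f) \<cdot> snd A = g \<cdot> (f \<cdot> snd A)" using assoc[OF A fh gh] by simp
    also have "\<dots> = (g \<cdot> snd B) \<cdot> arm (Endo M) f" 
      using assoc[OF Mf B gh] f by (simp add: alg_hom_def)
    also have "\<dots> = snd D \<cdot> arm (Endo M) (g \<cdot> f)"
      using assoc[OF Mf Mg D] g by (simp add: alg_hom_def functor_comp[OF M fh gh])
    finally show ?thesis using f g fh gh by (simp add: alg_hom_def comp_hom)
  qed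
  show ?thesis
  proof
    fix f assume "f \<in> Arr (alg_cat C M)"
    then show "Dom (alg_cat C M) f \<in> Obj (alg_cat C M)" "Cod (alg_cat C M) f \<in> Obj (alg_cat C M)"
      by (auto simp: alg_hom_def)
  next
    fix X assume "X \<in> Obj (alg_cat C M)"
    then show "Id (alg_cat C M) X \<in> hom (alg_cat C M) X X" by (auto simp: hom_alg_cat idh)
  next
    fix f g X Y Z assume "f \<in> hom (alg_cat C M) X Y" "g \<in> hom (alg_cat C M) Y Z"
    then show "g \<cdot>\<^bsub>alg_cat C M\<^esub> f \<in> hom (alg_cat C M) X Z"
      by (auto simp: hom_alg_cat intro: comph)
  next
    fix f X Y assume "f \<in> hom (alg_cat C M) X Y"
    then show "Id (alg_cat C M) Y \<cdot>\<^bsub>alg_cat C M\<^esub> f = f" "f \<cdot>\<^bsub>alg_cat C M\<^esub> Id (alg_cat C M) X = f"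
      by (auto simp: hom_alg_cat alg_hom_def id_left id_right)
  next
    fix f g h W X Y Z
    assume "f \<in> hom (alg_cat C M) W X" "g \<in> hom (alg_cat C M) X Y" "h \<in> hom (alg_cat C M) Y Z"
    then show "h \<cdot>\<^bsub>alg_cat C M\<^esub> (g \<cdot>\<^bsub>alg_cat C M\<^esub> f) = (h \<cdot>\<^bsub>alg_cat C M\<^esub> g) \<cdot>\<^bsub>alg_cat C M\<^esub> f"
      by (auto simp: hom_alg_cat alg_hom_def intro: assoc)
  qed
qed

text \<open>
  The unit laws of a monad together with a cancellation property of the unit. Cancellation is
  demanded only against morphisms into objects of the form \<open>M Y\<close>: the composite of an epireflector
  with a monad has units that cancel against morphisms into the reflective subcategory, where the
  values of \<open>M\<close> lie. By \<open>inverse_of_unit\<close>, the multiplication at \<open>X\<close> is then inverse to the unit at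
  \<open>M X\<close>, so its naturality and associativity follow.
\<close>

locale cancellable_unit = category C for C :: "('o, 'm) cat" (structure) +
  fixes M :: "('o, 'm) mnd"
  assumes unit_nat: "nat_trans C C fid (Endo M) (Unit M)"
    and mult_hom: "X \<in> Obj C \<Longrightarrow>
      Mult M X \<in> hom C (obm (Endo M) (obm (Endo M) X)) (obm (Endo M) X)"
    and mult_map_unit: "X \<in> Obj C \<Longrightarrow>
      Mult M X \<cdot> arm (Endo M) (Unit M X) = Id C (obm (Endo M) X)"
    and mult_unit: "X \<in> Obj C \<Longrightarrow>
      Mult M X \<cdot> Unit M (obm (Endo M) X) = Id C (obm (Endo M) X)"
    and unit_cancel: "X \<in> Obj C \<Longrightarrow> Y \<in> Obj C \<Longrightarrow>
      f \<in> hom C (obm (Endo M) X) (obm (Endo M) Y) \<Longrightarrow>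
      g \<in> hom C (obm (Endo M) X) (obm (Endo M) Y) \<Longrightarrow>
      f \<cdot> Unit M X = g \<cdot> Unit M X \<Longrightarrow> f = g"
begin

abbreviation F where "F \<equiv> obm (Endo M)"
abbreviation "Fm \<equiv> arm (Endo M)"
abbreviation "u \<equiv> Unit M"

definition unit_fixed :: "'o set" where
  "unit_fixed = {X \<in> Obj C. iso C (u X)}"

lemma functor_M: "is_functor C C (Endo M)"
  using unit_nat by (simp add: nat_trans_def)

lemma unit_hom: "X \<in> Obj C \<Longrightarrow> u X \<in> hom C X (F X)"
  using nat_hom[OF unit_nat] by simp

lemma unit_natural: "f \<in> hom C X Y \<Longrightarrow> u Y \<cdot> f = Fm f \<cdot> u X"
  using naturality[OF unit_nat] by simp

text \<open>
  Both \<open>u X \<cdot> a\<close> and the identity are endomorphisms of \<open>F X\<close> that agree after composition with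
  \<open>u X\<close>, so a retraction of the unit is an inverse.
\<close>

lemma inverse_of_unit:
  assumes X: "X \<in> Obj C" and a: "a \<in> hom C (F X) X" and au: "a \<cdot> u X = Id C X"
  shows "inverse_of C (u X) a"
proof -
  note u = unit_hom[OF X]
  have "(u X \<cdot> a) \<cdot> u X = u X \<cdot> (a \<cdot> u X)" using assoc[OF u a u] by simp
  also have "\<dots> = Id C (F X) \<cdot> u X" using au u by (simp add: id_left id_right)
  finally have "u X \<cdot> a = Id C (F X)"
    using unit_cancel[OF X X comp_hom[OF a u] id_hom] functor_obj[OF functor_M X] by simp
  then show ?thesis using a au by (simp add: inverse_of_hom[OF u])
qed

lemma F_unit_fixed: "X \<in> Obj C \<Longrightarrow> F X \<in> unit_fixed"
  using inverse_of_unit[OF _ mult_hom mult_unit] functor_obj[OF functor_M]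
  by (auto simp: unit_fixed_def iso_def)

text \<open>
  If \<open>a\<close> is inverse to \<open>u X\<close>, then \<open>M a\<close> is inverse to \<open>M (u X)\<close>, of which the multiplication is a
  left inverse. Hence \<open>M a\<close> equals the multiplication, and the associativity law for \<open>a\<close> holds.
\<close>

lemma algebra_iff: "(X, a) \<in> algebras C M \<longleftrightarrow> X \<in> Obj C \<and> inverse_of C (u X) a"
proof (intro iffI conjI; (elim conjE)?)
  assume "(X, a) \<in> algebras C M"
  then show "X \<in> Obj C" "inverse_of C (u X) a"
    by (auto simp: algebras_def intro: inverse_of_unit)
next
  assume X: "X \<in> Obj C" and inv: "inverse_of C (u X) a"
  note u = unit_hom[OF X]
  have a: "a \<in> hom C (F X) X" and au: "a \<cdot> u X = Id C X" and ua: "u X \<cdot> a = Id C (F X)"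
    using inv by (simp_all add: inverse_of_hom[OF u])
  note Fu = functor_hom[OF functor_M u] and Fa = functor_hom[OF functor_M a]
  have "Fm a = (Mult M X \<cdot> Fm (u X)) \<cdot> Fm a"
    using Fa by (simp add: mult_map_unit[OF X] id_left)
  also have "\<dots> = Mult M X \<cdot> Fm (u X \<cdot> a)"
    using assoc[OF Fa Fu mult_hom[OF X]] by (simp add: functor_comp[OF functor_M a u])
  also have "\<dots> = Mult M X"
    using mult_hom[OF X] functor_obj[OF functor_M X] by (simp add: ua functor_id[OF functor_M] id_right)
  finally show "(X, a) \<in> algebras C M" using X a au by (simp add: algebras_def)
qed

text \<open>
  Algebra structures are inverses of units, so the condition on a homomorphism is the naturality
  square of the unit with its vertical arrows inverted.
\<close>

lemma alg_hom_iff: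
  "alg_hom C M (X, a) (Y, b) f \<longleftrightarrow>
   (X, a) \<in> algebras C M \<and> (Y, b) \<in> algebras C M \<and> f \<in> hom C X Y"
proof -
  have "f \<cdot> a = b \<cdot> Fm f"
    if f: "f \<in> hom C X Y" and X: "X \<in> Obj C" and ia: "inverse_of C (u X) a"
      and Y: "Y \<in> Obj C" and ib: "inverse_of C (u Y) b"
  proof -
    note uX = unit_hom[OF X] and uY = unit_hom[OF Y]
    have a: "a \<in> hom C (F X) X" "u X \<cdot> a = Id C (F X)"
      and b: "b \<in> hom C (F Y) Y" "b \<cdot> u Y = Id C Y"
      using ia ib by (simp_all add: inverse_of_hom[OF uX] inverse_of_hom[OF uY])
    note Ff = functor_hom[OF functor_M f]
    have "f \<cdot> a = (b \<cdot> (u Y \<cdot> f)) \<cdot> a"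
      using assoc[OF f uY b(1)] f b(2) by (simp add: id_left)
    also have "\<dots> = (b \<cdot> Fm f) \<cdot> (u X \<cdot> a)"
      using assoc[OF uX Ff b(1)] assoc[OF a(1) uX comp_hom[OF Ff b(1)]]
      by (simp add: unit_natural[OF f])
    also have "\<dots> = b \<cdot> Fm f" using comp_hom[OF Ff b(1)] a(2) by (simp add: id_right)
    finally show ?thesis .
  qed
  then show ?thesis by (auto simp: alg_hom_def algebra_iff)
qed

lemma alg_cat_isomorphic_unit_fixed: "isomorphic (alg_cat C M) (full_sub C unit_fixed)"
proof -
  define J where "J = \<lparr>obm = (\<lambda>X. (X, inv_arr C (u X))),
    arm = (\<lambda>f. ((Dom C f, inv_arr C (u (Dom C f))), f, (Cod C f, inv_arr C (u (Cod C f)))))\<rparr>"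
  have alg: "(X, inv_arr C (u X)) \<in> algebras C M" if "X \<in> unit_fixed" for X
    using that inv_arr_inverse by (auto simp: algebra_iff unit_fixed_def)
  have alg_obj: "X \<in> unit_fixed" and alg_inv: "a = inv_arr C (u X)" if "(X, a) \<in> algebras C M" for X a
    using that inv_arr_eq by (auto simp: algebra_iff unit_fixed_def iso_def)
  have cat: "category (alg_cat C M)" by (rule category_alg_cat[OF functor_M])
  have sub: "category (full_sub C unit_fixed)"
    by (rule category_full_sub) (auto simp: unit_fixed_def)
  have "is_functor (alg_cat C M) (full_sub C unit_fixed) forget"
    using cat sub
    by (auto simp: is_functor_def forget_def hom_alg_cat hom_full_sub alg_hom_iff intro: alg_obj)
  moreover have "is_functor (full_sub C unit_fixed) (alg_cat C M) J"
  proof -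
    have "Dom C (Id C X) = X" "Cod C (Id C X) = X" if "X \<in> unit_fixed" for X
      using that id_hom by (auto simp: hom_def unit_fixed_def)
    moreover have "Dom C (g \<cdot> f) = Dom C f" "Cod C (g \<cdot> f) = Cod C g"
      if "f \<in> Arr C" "g \<in> Arr C" "Cod C f = Dom C g" for f g
      using comp_hom[of f "Dom C f" "Cod C f" g "Cod C g"] that by (auto simp: hom_def)
    ultimately show ?thesis
      using cat sub
      by (auto simp: is_functor_def J_def hom_alg_cat hom_full_sub alg_hom_iff alg hom_def)
  qed
  moreover have "functor_eq (alg_cat C M) (J \<circ>\<^sub>F forget) fid"
    using alg_inv by (auto simp: functor_eq_def J_def forget_def alg_hom_iff hom_def)
  moreover have "functor_eq (full_sub C unit_fixed) (forget \<circ>\<^sub>F J) fid"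
    by (auto simp: functor_eq_def J_def forget_def)
  ultimately show ?thesis unfolding isomorphic_def by blast
qed

text \<open>
  A morphism \<open>f : X \<rightarrow> Y\<close> into a fixed object extends along \<open>u X\<close> by naturality as the inverse of
  \<open>u Y\<close> after \<open>M f\<close>. Two extensions become equal after composition with \<open>u Y\<close>, where the
  cancellation property applies because the codomain is then \<open>F Y\<close>.
\<close>

lemma reflector_unit_fixed: "reflector C unit_fixed (Endo M) u"
proof (rule reflectorI)
  show "unit_fixed \<subseteq> Obj C" by (auto simp: unit_fixed_def)
  show "nat_trans C C fid (Endo M) u" by (rule unit_nat)
  show "X \<in> Obj C \<Longrightarrow> F X \<in> unit_fixed" for X by (rule F_unit_fixed)
  show "replete C unit_fixed"
    unfolding replete_def
  proof (intro allI impI, elim conjE)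
    fix f assume i: "iso C f" and D: "Dom C f \<in> unit_fixed"
    define X Y where "X = Dom C f" and "Y = Cod C f"
    have f: "f \<in> hom C X Y" using i by (auto simp: X_def Y_def iso_def inverse_of_def hom_def)
    then have X: "X \<in> Obj C" and Y: "Y \<in> Obj C" using hom_obj by auto
    obtain g where inv: "inverse_of C f g" using i by (auto simp: iso_def)
    then have g: "g \<in> hom C Y X" "g \<cdot> f = Id C X" "f \<cdot> g = Id C Y"
      by (simp_all add: inverse_of_hom[OF f])
    obtain a where a: "a \<in> hom C (F X) X" "a \<cdot> u X = Id C X"
      using D by (auto simp: unit_fixed_def X_def[symmetric] iso_def inverse_of_hom[OF unit_hom[OF X]])
    note Fg = functor_hom[OF functor_M g(1)]
    \<comment> \<open>Transporting the inverse of \<open>u X\<close> along \<open>f\<close> gives a retraction of \<open>u Y\<close>, which suffices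
       by cancellation.\<close>
    have "(f \<cdot> (a \<cdot> Fm g)) \<cdot> u Y = f \<cdot> (a \<cdot> (Fm g \<cdot> u Y))"
      using assoc[OF unit_hom[OF Y] comp_hom[OF Fg a(1)] f] assoc[OF unit_hom[OF Y] Fg a(1)] by simp
    also have "\<dots> = f \<cdot> ((a \<cdot> u X) \<cdot> g)"
      using assoc[OF g(1) unit_hom[OF X] a(1)] by (simp add: unit_natural[OF g(1)])
    also have "\<dots> = Id C Y" using a g by (simp add: id_left)
    finally have "inverse_of C (u Y) (f \<cdot> (a \<cdot> Fm g))"
      using inverse_of_unit[OF Y comp_hom[OF comp_hom[OF Fg a(1)] f]] by simp
    then show "Cod C f \<in> unit_fixed" using Y by (auto simp: unit_fixed_def iso_def Y_def)
  qed
  fix X Y f assume Yf: "Y \<in> unit_fixed" and f: "f \<in> hom C X Y"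
  then have X: "X \<in> Obj C" and Y: "Y \<in> Obj C" using hom_obj by auto
  note uX = unit_hom[OF X] and uY = unit_hom[OF Y] and Ff = functor_hom[OF functor_M f]
  obtain b where b: "b \<in> hom C (F Y) Y" "b \<cdot> u Y = Id C Y" 
    using Yf by (auto simp: unit_fixed_def iso_def inverse_of_hom[OF uY])
  show "\<exists>!g. g \<in> hom C (F X) Y \<and> g \<cdot> u X = f"
  proof (intro ex1I conjI; (elim conjE)?)
    show bf: "b \<cdot> Fm f \<in> hom C (F X) Y" by (rule comp_hom[OF Ff b(1)])
    have "(b \<cdot> Fm f) \<cdot> u X = (b \<cdot> u Y) \<cdot> f"
      using assoc[OF uX Ff b(1)] assoc[OF f uY b(1)] by (simp add: unit_natural[OF f])
    then show bfu: "(b \<cdot> Fm f) \<cdot> u X = f" using f b by (simp add: id_left)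
    fix g assume g: "g \<in> hom C (F X) Y" and gu: "g \<cdot> u X = f"
    have "(u Y \<cdot> g) \<cdot> u X = Fm f \<cdot> u X" 
      using assoc[OF uX g uY] gu by (simp add: unit_natural[OF f])
    then have "u Y \<cdot> g = Fm f" by (rule unit_cancel[OF X Y comp_hom[OF g uY] Ff])
    then show "g = b \<cdot> Fm f" using assoc[OF g uY b(1)] g b by (simp add: id_left)
  qed
qed

end

section \<open>The composite monad\<close>

lemma free_algebra:
  assumes "monad C T" "X \<in> Obj C"
  shows "(obm (Endo T) X, Mult T X) \<in> algebras C T"
proof -
  have "is_functor C C (Endo T)" using assms by (simp add: monad_def nat_trans_def)
  then show ?thesis
    using assms nat_hom[of C C "Endo T \<circ>\<^sub>F Endo T" "Endo T" "Mult T" X]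
    by (auto simp: algebras_def monad_def functor_obj)
qed

text \<open>
  The last equation says that \<open>r X\<close> is a homomorphism of \<open>T\<close>-algebras; it comes from \<open>r X\<close>
  underlying a component of the unit of the lifted monad.
\<close>

lemma lifting_algebra:
  assumes lift: "monad_lifting C (reflector_monad C R r) T L" and A: "(X, a) \<in> algebras C T"
  obtains b where "obm (Endo L) (X, a) = (obm R X, b)" "(obm R X, b) \<in> algebras C T"
    "r X \<cdot>\<^bsub>C\<^esub> a = b \<cdot>\<^bsub>C\<^esub> arm (Endo T) (r X)"
proof -
  let ?LA = "obm (Endo L) (X, a)"
  have nat: "nat_trans (alg_cat C T) (alg_cat C T) fid (Endo L) (Unit L)"
    and fst: "fst ?LA = obm R X" and unit: "arm forget (Unit L (X, a)) = r X"
    using lift A by (force simp: monad_lifting_def monad_def functor_eq_def forget_def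
        reflector_monad_def)+
  have "Unit L (X, a) \<in> hom (alg_cat C T) (X, a) ?LA" using nat_hom[OF nat] A by simp
  then have "alg_hom C T (X, a) ?LA (r X)" using unit by (auto simp: hom_alg_cat forget_def)
  moreover have "?LA = (obm R X, snd ?LA)" using fst by (simp add: prod_eq_iff)
  ultimately show ?thesis using that[of "snd ?LA"] by (simp add: alg_hom_def)
qed

text \<open>
  Cancellation uses \<open>u X = R (\<eta> X) \<cdot> r X\<close>: first \<open>r X\<close> cancels by the universal property of the
  reflection, then \<open>R (\<eta> X)\<close> because it is an epimorphism of the reflective subcategory. The unit
  laws reduce, after composing with components of \<open>r\<close>, to the unit laws of the algebra structure
  \<open>b\<close> on \<open>R (T X)\<close> and of \<open>T\<close>, the link being that \<open>r (T X)\<close> is a homomorphism of \<open>T\<close>-algebras.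
\<close>

lemma composite_cancellable_unit:
  fixes C :: "('o, 'm) cat" (structure)
  assumes refl: "reflector C A R r" and T: "monad C T"
    and lift: "monad_lifting C (reflector_monad C R r) T L"
    and epi: "\<And>X. X \<in> Obj C \<Longrightarrow> epi (full_sub C A) (arm R (Unit T X))"
  shows "cancellable_unit C (composite_monad C R r T L)"
proof -
  define S where "S = obm (Endo T)"
  let ?M = "composite_monad C R r T L"
  have R: "is_functor C C R" by (rule reflector_functor[OF refl])
  interpret category C using R by (simp add: is_functor_def)
  have Tf: "is_functor C C (Endo T)" and eta: "nat_trans C C fid (Endo T) (Unit T)"
    using T by (simp_all add: monad_def nat_trans_def)
  note r = reflector_nat[OF refl]
  have S: "S X \<in> Obj C" if "X \<in> Obj C" for X
    using functor_obj[OF Tf that] by (simp add: S_def)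
  have RO: "obm R X \<in> Obj C" if "X \<in> Obj C" for X
    using functor_obj[OF R that] .
  have rh: "r X \<in> hom C X (obm R X)" if "X \<in> Obj C" for X using nat_hom[OF r that] by simp
  have eh: "Unit T X \<in> hom C X (S X)" if "X \<in> Obj C" for X
    using nat_hom[OF eta that] by (simp add: S_def)
  have rn: "r Y \<cdot> f = arm R f \<cdot> r X" if "f \<in> hom C X Y" for f X Y
    using naturality[OF r that] by simp
  have en: "Unit T Y \<cdot> f = arm (Endo T) f \<cdot> Unit T X" if "f \<in> hom C X Y" for f X Y
    using naturality[OF eta that] by simp
  have endo: "Endo ?M = R \<circ>\<^sub>F Endo T" and unit: "Unit ?M X = r (S X) \<cdot> Unit T X" for X
    by (simp_all add: composite_monad_def Let_def S_def)
  have M: "is_functor C C (Endo ?M)" unfolding endo by (rule functor_fcomp[OF Tf R])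
  have uh: "Unit ?M X \<in> hom C X (obm R (S X))" if "X \<in> Obj C" for X
    unfolding unit by (rule comp_hom[OF eh[OF that] rh[OF S[OF that]]])
  have cancel_r: "f = g"
    if "X \<in> Obj C" "Y \<in> Obj C" "f \<in> hom C (obm R X) (obm R Y)" "g \<in> hom C (obm R X) (obm R Y)"
      "f \<cdot> r X = g \<cdot> r X" for f g X Y
    using reflector_universal[OF refl reflector_obj[OF refl that(2)] comp_hom[OF rh[OF that(1)] that(3)]]
      that by auto
  have mult: "Mult ?M X \<in> hom C (obm R (S (obm R (S X)))) (obm R (S X)) \<and>
      Mult ?M X \<cdot> Unit ?M (obm R (S X)) = Id C (obm R (S X)) \<and>
      Mult ?M X \<cdot> arm (Endo ?M) (Unit ?M X) = Id C (obm R (S X))" if X: "X \<in> Obj C" for X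
  proof -
    let ?Y = "obm R (S X)" and ?w = "Mult ?M X"
    have Y: "?Y \<in> Obj C" by (rule RO[OF S[OF X]])
    obtain b where Lb: "obm (Endo L) (S X, Mult T X) = (?Y, b)" and "(?Y, b) \<in> algebras C T"
      and rb: "r (S X) \<cdot> Mult T X = b \<cdot> arm (Endo T) (r (S X))"
      using lifting_algebra[OF lift free_algebra[OF T X]] by (auto simp: S_def)
    then have b: "b \<in> hom C (S ?Y) ?Y" and be: "b \<cdot> Unit T ?Y = Id C ?Y"
      by (auto simp: algebras_def S_def)
    have "?w = (THE w. w \<in> hom C (obm R (S ?Y)) ?Y \<and> w \<cdot> r (S ?Y) = b)"
      using Lb by (simp add: composite_monad_def Let_def S_def)
    with theI'[OF reflector_universal[OF refl reflector_obj[OF refl S[OF X]] b]]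
    have w: "?w \<in> hom C (obm R (S ?Y)) ?Y" and wr: "?w \<cdot> r (S ?Y) = b"
      by simp_all
    note rSY = rh[OF S[OF Y]] and rSX = rh[OF S[OF X]]
    have wu: "?w \<cdot> Unit ?M ?Y = Id C ?Y"
      using assoc[OF eh[OF Y] rSY w] wr be by (simp add: unit)
    note Mu = functor_hom[OF M uh[OF X], unfolded endo, simplified, folded S_def]
    note Tu = functor_hom[OF Tf uh[OF X], folded S_def]
    have Te: "arm (Endo T) (Unit T X) \<in> hom C (S X) (S (S X))"
      and Tr: "arm (Endo T) (r (S X)) \<in> hom C (S (S X)) (S ?Y)"
      using functor_hom[OF Tf eh[OF X]] functor_hom[OF Tf rSX] by (simp_all add: S_def)
    have mu: "Mult T X \<in> hom C (S (S X)) (S X)" 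
      and mue: "Mult T X \<cdot> arm (Endo T) (Unit T X) = Id C (S X)"
      using T X by (auto simp: monad_def nat_trans_def S_def)
    have "(?w \<cdot> arm (Endo ?M) (Unit ?M X)) \<cdot> r (S X) = ?w \<cdot> (r (S ?Y) \<cdot> arm (Endo T) (Unit ?M X))"
      using assoc[OF rSX Mu w] by (simp add: endo rn[OF Tu])
    also have "\<dots> = b \<cdot> arm (Endo T) (r (S X) \<cdot> Unit T X)"
      using assoc[OF Tu rSY w] wr by (simp add: unit)
    also have "\<dots> = (b \<cdot> arm (Endo T) (r (S X))) \<cdot> arm (Endo T) (Unit T X)"
      using assoc[OF Te Tr b] by (simp add: functor_comp[OF Tf eh[OF X] rSX])
    also have "\<dots> = r (S X) \<cdot> (Mult T X \<cdot> arm (Endo T) (Unit T X))"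
      using assoc[OF Te mu rSX] by (simp add: rb)
    also have "\<dots> = Id C ?Y \<cdot> r (S X)" using rSX by (simp add: mue id_left id_right)
    finally have "?w \<cdot> arm (Endo ?M) (Unit ?M X) = Id C ?Y"
      using cancel_r[OF S[OF X] S[OF X]] comp_hom[OF Mu w] id_hom[OF Y] by (simp add: endo)
    with w wu show ?thesis by simp
  qed
  show ?thesis
  proof
    have "Unit ?M Y \<cdot> f = arm (Endo ?M) f \<cdot> Unit ?M X" if f: "f \<in> hom C X Y" for f X Y
    proof -
      have X: "X \<in> Obj C" and Y: "Y \<in> Obj C" using hom_obj[OF f] by auto
      note TF = functor_hom[OF Tf f, folded S_def]
      note RTF = functor_hom[OF R TF]
      have "Unit ?M Y \<cdot> f = r (S Y) \<cdot> (arm (Endo T) f \<cdot> Unit T X)"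
        using assoc[OF f eh[OF Y] rh[OF S[OF Y]]] by (simp add: unit en[OF f])
      also have "\<dots> = (arm R (arm (Endo T) f) \<cdot> r (S X)) \<cdot> Unit T X"
        using assoc[OF eh[OF X] TF rh[OF S[OF Y]]] by (simp add: rn[OF TF])
      also have "\<dots> = arm (Endo ?M) f \<cdot> Unit ?M X"
        using assoc[OF eh[OF X] rh[OF S[OF X]] RTF] by (simp add: unit endo)
      finally show ?thesis .
    qed
    then show "nat_trans C C fid (Endo ?M) (Unit ?M)"
      using M uh functor_fid[OF category_axioms] by (auto simp: nat_trans_def endo S_def)
    fix X assume X: "X \<in> Obj C"
    show "Mult ?M X \<in> hom C (obm (Endo ?M) (obm (Endo ?M) X)) (obm (Endo ?M) X)"
      "Mult ?M X \<cdot> arm (Endo ?M) (Unit ?M X) = Id C (obm (Endo ?M) X)"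
      "Mult ?M X \<cdot> Unit ?M (obm (Endo ?M) X) = Id C (obm (Endo ?M) X)"
      using mult[OF X] by (simp_all add: endo S_def)
    fix Y f g assume Y: "Y \<in> Obj C" and "f \<in> hom C (obm (Endo ?M) X) (obm (Endo ?M) Y)"
      "g \<in> hom C (obm (Endo ?M) X) (obm (Endo ?M) Y)" and eq: "f \<cdot> Unit ?M X = g \<cdot> Unit ?M X"
    then have f: "f \<in> hom C (obm R (S X)) (obm R (S Y))" and g: "g \<in> hom C (obm R (S X)) (obm R (S Y))"
      by (simp_all add: endo S_def)
    note e = eh[OF X] and Re = functor_hom[OF R eh[OF X]]
    \<comment> \<open>The unit factors as \<open>R (\<eta> X) \<cdot> r X\<close>, whose two factors cancel one after the other.\<close>
    have u: "h \<cdot> Unit ?M X = (h \<cdot> arm R (Unit T X)) \<cdot> r X" 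
      if "h \<in> hom C (obm R (S X)) (obm R (S Y))" for h
      using assoc[OF rh[OF X] Re that] by (simp add: unit rn[OF e])
    have "f \<cdot> arm R (Unit T X) = g \<cdot> arm R (Unit T X)"
      using cancel_r[OF X S[OF Y] comp_hom[OF Re f] comp_hom[OF Re g]] eq u[OF f] u[OF g] by simp
    moreover have "Cod C (arm R (Unit T X)) = obm R (S X)" using Re by (simp add: hom_def)
    ultimately show "f = g"
      using epi[OF X] f g reflector_obj[OF refl S[OF X]] reflector_obj[OF refl S[OF Y]]
      by (auto simp: epi_def hom_full_sub)
  qed
qed

theorem proposition24:
  fixes C :: "('o, 'm) cat"
    and A :: "'o set"
    and R :: "('o, 'm, 'o, 'm) fctr"
    and r :: "'o \<Rightarrow> 'm"
    and T :: "('o, 'm) mnd"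
    and L :: "('o \<times> 'm, ('o \<times> 'm) \<times> 'm \<times> ('o \<times> 'm)) mnd"
  assumes "category C"
    and "epireflector C A R r"
    and "monad C T"
    and "monad_lifting C (reflector_monad C R r) T L"
    and "\<And>X. X \<in> Obj C \<Longrightarrow> epi (full_sub C A) (arm R (Unit T X))"
  shows "(\<exists>B. reflective (full_sub C A) B \<and>
            isomorphic (alg_cat C (composite_monad C R r T L)) (full_sub (full_sub C A) B)) \<and>
         (\<exists>B. reflective C B \<and>
            isomorphic (alg_cat C (composite_monad C R r T L)) (full_sub C B))"
proof -
  let ?M = "composite_monad C R r T L"
  have refl: "reflector C A R r" using assms(2) by (simp add: epireflector_def)
  interpret cancellable_unit C ?M
    by (rule composite_cancellable_unit[OF refl assms(3-5)])
  \<comment> \<open>A fixed object is isomorphic to its reflection \<open>R (T X)\<close>, and \<open>A\<close> is closed under isomorphism.\<close>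
  have "unit_fixed \<subseteq> A"
  proof
    fix X assume "X \<in> unit_fixed"
    then have X: "X \<in> Obj C" and "iso C (u X)" by (auto simp: unit_fixed_def)
    note u = unit_hom[OF X]
    then obtain a where a: "inverse_of C (u X) a" using \<open>iso C (u X)\<close> by (auto simp: iso_def)
    then have "a \<in> hom C (F X) X" by (simp add: inverse_of_hom[OF u])
    moreover have "F X \<in> A"
      using reflector_obj[OF refl functor_obj[of C C "Endo T" X]] assms(3) X
      by (simp add: composite_monad_def Let_def monad_def nat_trans_def)
    ultimately show "X \<in> A"
      using iso_inverse[OF a] refl by (auto simp: reflector_def replete_def hom_def)
  qed
  moreover have "A \<subseteq> Obj C" using refl by (simp add: reflector_def)
  ultimately have "reflector (full_sub C A) unit_fixed (Endo ?M) u"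
    and "full_sub (full_sub C A) unit_fixed = full_sub C unit_fixed"
    using reflector_restrict[OF reflector_unit_fixed] full_sub_full_sub by blast+
  then show ?thesis
    using reflector_unit_fixed alg_cat_isomorphic_unit_fixed unfolding reflective_def by metis
qed

end
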